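(* Let $m,r>0$, let $\mathbb{I}=\mathrm{diag}(I_1,I_2,I_3)$ with $I_1,I_2,I_3>0$, and on $\mathbb{R}^3\times\mathbb{R}^3\ni(\gamma,K)$ set $\Omega=\mathbb{I}^{-1}K$. The characteristic distribution of the almost Poisson bracket $$\{f,g\}'_{\mathrm{Rank}0}=-(K-mr^2\Omega)\cdot\left(\frac{\partial f}{\partial K}\times\frac{\partial g}{\partial K}\right)-\gamma\cdot\left(\frac{\partial f}{\partial K}\times\frac{\partial g}{\partial\gamma}-\frac{\partial g}{\partial K}\times\frac{\partial f}{\partial\gamma}\right)$$ on $\mathbb{R}^3\times\mathbb{R}^3$ is not integrable.
   Context: An almost Poisson bracket is a skew-symmetric bilinear bracket on smooth functions satisfying the Leibniz rule (not necessarily the Jacobi identity). The (almost) Hamiltonian vector field of $f$ is $X_f$ with $X_f(g)=\{g,f\}$. The characteristic distribution is the (possibly singular) distribution whose fibers are spanned by the (almost) Hamiltonian vector fields. It is integrable if through every point passes an immersed submanifold whose tangent spaces are the fibers of the distribution; in particular the Lie bracket of two vector fields with values in an integrable distribution again has values in it. *)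

theory Defs
  imports "HOL-Analysis.Analysis"
begin

primrec Ck_on :: "nat \<Rightarrow> 'a::euclidean_space set \<Rightarrow> ('a \<Rightarrow> 'b::euclidean_space) \<Rightarrow> bool" where
  "Ck_on 0 S f \<longleftrightarrow> continuous_on S f"
| "Ck_on (Suc k) S f \<longleftrightarrow>
     (\<forall>x\<in>S. f differentiable (at x)) \<and> (\<forall>v. Ck_on k S (\<lambda>x. frechet_derivative f (at x) v))"

text \<open>
  \<open>Ck_on\<close> is meant for open sets. On an arbitrary set, smooth means: locally the restriction of a
  smooth map defined on an open set of the ambient space. For open sets this is plain smoothness;
  for relatively open subsets of a linear subspace it is smoothness in linear coordinates of that
  subspace.
\<close>

definition smooth_on :: "'a::euclidean_space set \<Rightarrow> ('a \<Rightarrow> 'b::euclidean_space) \<Rightarrow> bool" where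
  "smooth_on S f \<longleftrightarrow>
     (\<forall>x\<in>S. \<exists>N g. open N \<and> x \<in> N \<and> (\<forall>k. Ck_on k N g) \<and> (\<forall>y\<in>S \<inter> N. g y = f y))"

text \<open>
  An immersed submanifold of the Euclidean space \<open>'a\<close> is a subset carrying its own topology \<open>T\<close>
  (not necessarily the subspace topology; the subset is \<open>topspace T\<close>) and a smooth structure for
  which the inclusion is an immersion. The smooth structure is an atlas \<open>A\<close> of local
  parametrizations \<open>(U, \<phi>)\<close>, where \<open>U\<close> is open in the model space. Since the dimension must be
  able to vary with the submanifold inside a formula, the model space is a linear subspace \<open>V\<close> of
  \<open>'a\<close>, in the role of \<open>\<real>\<^sup>k\<close> with \<open>k = dim V\<close>; an immersed submanifold of \<open>'a\<close> never has dimension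
  exceeding that of \<open>'a\<close>. Derivatives within \<open>U\<close> are unique only on \<open>V\<close>, so only their restriction
  to \<open>V\<close> is used.
\<close>

definition immersed_submanifold ::
    "'a::euclidean_space topology \<Rightarrow> 'a set \<Rightarrow> ('a set \<times> ('a \<Rightarrow> 'a)) set \<Rightarrow> bool" where
  "immersed_submanifold T V A \<longleftrightarrow>
     subspace V \<and>
     Hausdorff_space T \<and>
     (\<exists>B. countable B \<and> (\<forall>W\<in>B. openin T W) \<and>
          (\<forall>W x. openin T W \<and> x \<in> W \<longrightarrow> (\<exists>W'\<in>B. x \<in> W' \<and> W' \<subseteq> W))) \<and>
     (\<Union>(U, \<phi>)\<in>A. \<phi> ` U) = topspace T \<and>
     (\<forall>(U, \<phi>)\<in>A.
        openin (top_of_set V) U \<and>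
        openin T (\<phi> ` U) \<and>
        homeomorphic_map (top_of_set U) (subtopology T (\<phi> ` U)) \<phi> \<and>
        smooth_on U \<phi> \<and>
        (\<forall>u\<in>U. \<exists>\<phi>'. (\<phi> has_derivative \<phi>') (at u within U) \<and> inj_on \<phi>' V)) \<and>
     (\<forall>(U, \<phi>)\<in>A. \<forall>(W, \<psi>)\<in>A. smooth_on (U \<inter> \<phi> -` (\<psi> ` W)) (inv_into W \<psi> \<circ> \<phi>))"

definition tangent_space_at ::
    "'a::euclidean_space set \<Rightarrow> ('a set \<times> ('a \<Rightarrow> 'a)) set \<Rightarrow> 'a \<Rightarrow> 'a set" where
  "tangent_space_at V A q =
     {\<phi>' v | U \<phi> u \<phi>' v. (U, \<phi>) \<in> A \<and> u \<in> U \<and> \<phi> u = q \<and>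
        (\<phi> has_derivative \<phi>') (at u within U) \<and> v \<in> V}"

definition integrable_distribution :: "('a::euclidean_space \<Rightarrow> 'a set) \<Rightarrow> bool" where
  "integrable_distribution D \<longleftrightarrow>
     (\<forall>p. \<exists>T V A. immersed_submanifold T V A \<and> p \<in> topspace T \<and>
        (\<forall>q\<in>topspace T. tangent_space_at V A q = D q))"

definition is_hamiltonian_vf ::
    "(('a::euclidean_space \<Rightarrow> real) \<Rightarrow> ('a \<Rightarrow> real) \<Rightarrow> 'a \<Rightarrow> real) \<Rightarrow> ('a \<Rightarrow> real) \<Rightarrow> ('a \<Rightarrow> 'a) \<Rightarrow> bool"
  where
  "is_hamiltonian_vf br f X \<longleftrightarrow>
     (\<forall>g. smooth_on UNIV g \<longrightarrow> (\<forall>x. frechet_derivative g (at x) (X x) = br g f x))"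

definition characteristic_distribution ::
    "(('a::euclidean_space \<Rightarrow> real) \<Rightarrow> ('a \<Rightarrow> real) \<Rightarrow> 'a \<Rightarrow> real) \<Rightarrow> 'a \<Rightarrow> 'a set" where
  "characteristic_distribution br x =
     span {X x | X f. smooth_on UNIV f \<and> is_hamiltonian_vf br f X}"

definition gradient :: "('a::real_inner \<Rightarrow> real) \<Rightarrow> 'a \<Rightarrow> 'a" where
  "gradient f x = (THE D. GDERIV f x :> D)"

definition diag3 :: "real \<Rightarrow> real \<Rightarrow> real \<Rightarrow> real^3^3" where
  "diag3 a b c = vector [vector [a, 0, 0], vector [0, b, 0], vector [0, 0, c]]"

text \<open>Points of the phase space are pairs \<open>(\<gamma>, K)\<close>.\<close>

definition rank0_bracket ::
    "real \<Rightarrow> real \<Rightarrow> real^3^3 \<Rightarrow>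
     ((real^3) \<times> (real^3) \<Rightarrow> real) \<Rightarrow> ((real^3) \<times> (real^3) \<Rightarrow> real) \<Rightarrow> (real^3) \<times> (real^3) \<Rightarrow> real"
  where
  "rank0_bracket m r \<I> f g = (\<lambda>(\<gamma>, K).
     let \<Omega> = matrix_inv \<I> *v K;
         f\<^sub>\<gamma> = gradient (\<lambda>\<gamma>'. f (\<gamma>', K)) \<gamma>; f\<^sub>K = gradient (\<lambda>K'. f (\<gamma>, K')) K;
         g\<^sub>\<gamma> = gradient (\<lambda>\<gamma>'. g (\<gamma>', K)) \<gamma>; g\<^sub>K = gradient (\<lambda>K'. g (\<gamma>, K')) K
     in - ((K - (m * r\<^sup>2) *\<^sub>R \<Omega>) \<bullet> cross3 f\<^sub>K g\<^sub>K) - \<gamma> \<bullet> (cross3 f\<^sub>K g\<^sub>\<gamma> - cross3 g\<^sub>K f\<^sub>\<gamma>))"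

end

theory Submission
  imports Defs
begin

text \<open>
  With \<open>M(K) = K - m r\<^sup>2 \<Omega>\<close>, the Hamiltonian vector field of a function with gradients
  \<open>b\<close> in \<open>\<gamma>\<close> and \<open>a\<close> in \<open>K\<close> is \<open>(\<gamma> \<times> a, M(K) \<times> a + \<gamma> \<times> b)\<close>, so the one-form
  \<open>\<alpha> = \<gamma> \<bullet> dK + M(K) \<bullet> d\<gamma>\<close> annihilates the characteristic distribution. On an integral
  manifold the pullback of \<open>\<alpha>\<close>, hence that of \<open>d\<alpha>\<close>, would vanish. But at \<open>(e\<^sub>3, 0)\<close> the
  distribution contains \<open>(e\<^sub>1, 0)\<close> and \<open>(0, e\<^sub>1)\<close>, and \<open>d\<alpha>\<close> takes the value
  \<open>m r\<^sup>2 / I\<^sub>1 \<noteq> 0\<close> on this pair.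
\<close>

section \<open>Smooth maps and second derivatives\<close>

text \<open>Two applications of the mean value theorem, first along \<open>v\<close> and then along
  \<open>w\<close>, give an exact formula. Its left side is symmetric in \<open>v\<close> and
  \<open>w\<close>, its right side not visibly so.\<close>

lemma second_difference_eq:
  fixes f :: "'a::real_normed_vector \<Rightarrow> real"
  assumes N: "cball x (s * (norm v + norm w)) \<subseteq> N" and s: "s > 0"
    and F: "\<And>y. y \<in> N \<Longrightarrow> (f has_derivative F y) (at y)"
    and G: "\<And>y. y \<in> N \<Longrightarrow> ((\<lambda>z. F z v) has_derivative G y) (at y)"
  obtains y where "y \<in> cball x (s * (norm v + norm w))"
    "f (x + s *\<^sub>R v + s *\<^sub>R w) - f (x + s *\<^sub>R v) - f (x + s *\<^sub>R w) + f x = s\<^sup>2 * G y w"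
proof -
  have ball: "x + a *\<^sub>R v + b *\<^sub>R w \<in> cball x (s * (norm v + norm w))"
    if "0 \<le> a" "a \<le> s" "0 \<le> b" "b \<le> s" for a b
  proof -
    have "norm (a *\<^sub>R v + b *\<^sub>R w) \<le> a * norm v + b * norm w"
      using that norm_triangle_ineq[of "a *\<^sub>R v" "b *\<^sub>R w"] by simp
    also have "\<dots> \<le> s * norm v + s * norm w"
      using that by (intro add_mono mult_right_mono) auto
    finally have "dist x (x + (a *\<^sub>R v + b *\<^sub>R w)) \<le> s * (norm v + norm w)"
      by (subst dist_commute) (simp add: dist_norm distrib_left)
    then show ?thesis
      by (simp add: add.assoc)
  qed
  then have mem: "x + a *\<^sub>R v + b *\<^sub>R w \<in> N"
    if "0 \<le> a" "a \<le> s" "0 \<le> b" "b \<le> s" for a b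
    using N that by blast
  have line: "((\<lambda>t. h (y + t *\<^sub>R u)) has_real_derivative h' u) (at t)"
    if "(h has_derivative h') (at (y + t *\<^sub>R u))" for h h' y u t
  proof -
    have "((\<lambda>t. h (y + t *\<^sub>R u)) has_derivative (\<lambda>d. h' (d *\<^sub>R u))) (at t)"
      by (rule has_derivative_compose[where f = "\<lambda>t. y + t *\<^sub>R u", OF _ that]) (auto intro!: derivative_eq_intros)
    moreover have "h' (d *\<^sub>R u) = h' u * d" for d
      using has_derivative_linear[OF that] by (simp add: linear_cmul)
    ultimately show ?thesis
      by (simp add: has_field_derivative_def)
  qed
  \<comment> \<open>The difference in direction \<open>w\<close>, as a function of the position
    \<open>a\<close> along \<open>v\<close>; \<open>k s - k 0\<close> is the second
    difference.\<close>
  define k where "k = (\<lambda>a. f (x + s *\<^sub>R w + a *\<^sub>R v) - f (x + a *\<^sub>R v))"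
  have "(k has_real_derivative F (x + s *\<^sub>R w + a *\<^sub>R v) v - F (x + a *\<^sub>R v) v) (at a)"
    if "0 \<le> a" "a \<le> s" for a
    unfolding k_def using mem[of a s] mem[of a 0] that s
    by (intro DERIV_diff line F) (auto simp: algebra_simps)
  from MVT2[OF s this] obtain a where a: "0 < a" "a < s"
    and ka: "k s - k 0 = s * (F (x + s *\<^sub>R w + a *\<^sub>R v) v - F (x + a *\<^sub>R v) v)"
    by auto
  have "((\<lambda>b. F (x + a *\<^sub>R v + b *\<^sub>R w) v) has_real_derivative G (x + a *\<^sub>R v + b *\<^sub>R w) w) (at b)"
    if "0 \<le> b" "b \<le> s" for b
    by (rule line[of "\<lambda>z. F z v"], rule G) (use mem[of a b] that a in auto)
  from MVT2[OF s this] obtain b where b: "0 < b" "b < s"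
    and "F (x + a *\<^sub>R v + s *\<^sub>R w) v - F (x + a *\<^sub>R v) v = s * G (x + a *\<^sub>R v + b *\<^sub>R w) w"
    by auto
  then have "k s - k 0 = s\<^sup>2 * G (x + a *\<^sub>R v + b *\<^sub>R w) w"
    using ka by (simp add: power2_eq_square algebra_simps)
  then show thesis
    using that[OF ball[of a b]] a b by (simp add: k_def algebra_simps)
qed

text \<open>Expanding the same second difference in both orders equates the two mixed derivatives at
  two points near \<open>x\<close>, which may differ; continuity carries the equality to
  \<open>x\<close>.\<close>

lemma symmetric_second_derivative_real:
  fixes f :: "'a::real_normed_vector \<Rightarrow> real"
  assumes N: "open N" "x \<in> N"
    and F: "\<And>y. y \<in> N \<Longrightarrow> (f has_derivative F y) (at y)"
    and G: "\<And>y v. y \<in> N \<Longrightarrow> ((\<lambda>z. F z v) has_derivative G v y) (at y)"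
    and cont: "\<And>v w. continuous_on N (\<lambda>y. G v y w)"
  shows "G v x w = G w x v"
proof (rule ccontr)
  assume neq: "G v x w \<noteq> G w x v"
  \<comment> \<open>Half the supposed gap, so that two errors below \<open>e\<close> cannot fill
    it.\<close>
  define e where "e = \<bar>G v x w - G w x v\<bar> / 2"
  have e: "e > 0" using neq by (simp add: e_def)
  have ev: "\<forall>\<^sub>F y in nhds x. dist (G a y b) (G a x b) < e" for a b
  proof -
    have "isCont (\<lambda>y. G a y b) x"
      using cont N by (simp add: continuous_on_eq_continuous_at)
    then have "\<forall>\<^sub>F y in at x. dist (G a y b) (G a x b) < e"
      using e by (simp add: isCont_def tendsto_iff)
    then show ?thesis
      using e by (simp add: eventually_nhds_conv_at)
  qed
  have "\<forall>\<^sub>F y in nhds x. y \<in> N \<and> dist (G v y w) (G v x w) < e \<and> dist (G w y v) (G w x v) < e"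
    by (intro eventually_conj ev eventually_nhds_in_open N)
  then obtain d where d: "d > 0" and
    dd: "\<And>y. dist y x < d \<Longrightarrow> y \<in> N \<and> dist (G v y w) (G v x w) < e \<and> dist (G w y v) (G w x v) < e"
    by (auto simp: eventually_nhds_metric)
  \<comment> \<open>The summand 1 keeps the denominator positive and makes the closed ball of radius
    \<open>s * (norm v + norm w)\<close> fit strictly inside the ball of radius
    \<open>d\<close>.\<close>
  define s where "s = d / (norm v + norm w + 1)"
  have s: "s > 0" unfolding s_def using d by (intro divide_pos_pos) (auto intro: add_nonneg_pos)
  have sd: "s * (norm v + norm w) < d"
  proof -
    have "s * (norm v + norm w + 1) = d"
      unfolding s_def using add_nonneg_pos[of "norm v + norm w" 1] by simp
    then show ?thesis using s by (simp add: algebra_simps)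
  qed
  have sub: "cball x (s * (norm v + norm w)) \<subseteq> N"
    using dd sd by (force simp: dist_commute)
  obtain y where y: "y \<in> cball x (s * (norm v + norm w))"
    "f (x + s *\<^sub>R v + s *\<^sub>R w) - f (x + s *\<^sub>R v) - f (x + s *\<^sub>R w) + f x = s\<^sup>2 * G v y w"
    by (rule second_difference_eq[OF sub s F G])
  have sub': "cball x (s * (norm w + norm v)) \<subseteq> N"
    using sub by (simp add: add.commute)
  obtain z where z: "z \<in> cball x (s * (norm w + norm v))"
    "f (x + s *\<^sub>R w + s *\<^sub>R v) - f (x + s *\<^sub>R w) - f (x + s *\<^sub>R v) + f x = s\<^sup>2 * G w z v"
    by (rule second_difference_eq[OF sub' s F G])
  have comm: "x + s *\<^sub>R w + s *\<^sub>R v = x + s *\<^sub>R v + s *\<^sub>R w"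
    by simp
  have "s\<^sup>2 * G v y w = s\<^sup>2 * G w z v"
    using y(2) z(2) unfolding comm by linarith
  then have "G v y w = G w z v" using s by simp
  moreover have "dist (G v y w) (G v x w) < e"
    using dd[of y] y(1) sd by (simp add: dist_commute)
  moreover have "dist (G w z v) (G w x v) < e"
    using dd[of z] z(1) sd by (simp add: dist_commute add.commute)
  ultimately show False
    unfolding e_def dist_real_def by (auto simp: abs_if field_simps split: if_splits)
qed

lemma Ck_on_2_symmetric:
  fixes g :: "'a::euclidean_space \<Rightarrow> 'b::euclidean_space"
  assumes "Ck_on 2 N g" "open N" "x \<in> N"
  shows "frechet_derivative (\<lambda>y. frechet_derivative g (at y) v) (at x) w =
         frechet_derivative (\<lambda>y. frechet_derivative g (at y) w) (at x) v"
proof (rule euclidean_eqI)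
  let ?F = "\<lambda>y v. frechet_derivative g (at y) v"
  let ?G = "\<lambda>v y. frechet_derivative (\<lambda>z. ?F z v) (at y)"
  fix b :: 'b assume "b \<in> Basis"
  have g: "(g has_derivative ?F y) (at y)"
    and F: "((\<lambda>z. ?F z u) has_derivative ?G u y) (at y)" if "y \<in> N" for y u
    using assms(1) that by (auto simp: numeral_2_eq_2 frechet_derivative_works[symmetric])
  have cont: "continuous_on N (\<lambda>y. ?G u y u')" for u u'
    using assms(1) by (auto simp: numeral_2_eq_2)
  show "?G v x w \<bullet> b = ?G w x v \<bullet> b"
    by (rule symmetric_second_derivative_real[OF assms(2,3), of "\<lambda>y. g y \<bullet> b" "\<lambda>y u. ?F y u \<bullet> b"
          "\<lambda>u y u'. ?G u y u' \<bullet> b"])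
      (auto intro!: has_derivative_inner_left g F continuous_intros cont)
qed

section \<open>Smooth maps on arbitrary sets\<close>

text \<open>Derivatives within a piece of a subspace are not unique in the ambient space. A local
  extension \<open>g\<close> supplies one definite choice that can itself be differentiated; order 2
  is what the symmetry of second derivatives requires.\<close>

lemma smooth_on_has_derivative_extension:
  assumes "smooth_on S f" "x \<in> S"
  shows "\<exists>N g. open N \<and> x \<in> N \<and> Ck_on 2 N g \<and> (\<forall>y\<in>S \<inter> N. g y = f y) \<and>
    (\<forall>y\<in>N. (g has_derivative frechet_derivative g (at y)) (at y)) \<and>
    (\<forall>y\<in>S \<inter> N. (f has_derivative frechet_derivative g (at y)) (at y within S))"
proof -
  from assms have "\<exists>N g. open N \<and> x \<in> N \<and> (\<forall>k. Ck_on k N g) \<and> (\<forall>y\<in>S \<inter> N. g y = f y)"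
    unfolding smooth_on_def by (rule bspec)
  then obtain N g where N: "open N" "x \<in> N" "\<forall>k. Ck_on k N g" "\<forall>y\<in>S \<inter> N. g y = f y"
    by (elim exE conjE)
  have g: "(g has_derivative frechet_derivative g (at y)) (at y)" if "y \<in> N" for y
    using N(3)[rule_format, of 1] that by (simp add: frechet_derivative_works[symmetric])
  have f: "(f has_derivative frechet_derivative g (at y)) (at y within S)" if "y \<in> S \<inter> N" for y
  proof (rule has_derivative_transform_eventually)
    show "(g has_derivative frechet_derivative g (at y)) (at y within S)"
      using g that by (auto intro: has_derivative_at_withinI)
    have "\<forall>\<^sub>F z in at y within S. z \<in> N \<and> z \<in> S"
      using that N(1) by (auto simp: eventually_at_topological)
    then show "\<forall>\<^sub>F z in at y within S. g z = f z"
      by eventually_elim (use N(4) in auto)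
  qed (use that N(4) in auto)
  show ?thesis
    using N g f by (intro exI[of _ N] exI[of _ g]) simp
qed

lemma smooth_on_UNIV_differentiable:
  assumes "smooth_on UNIV f"
  shows "f differentiable (at x)"
  using smooth_on_has_derivative_extension[OF assms UNIV_I, of x]
  by (metis IntI UNIV_I differentiableI)

lemma Ck_on_const: "Ck_on k S (\<lambda>_. c)"
  by (induction k arbitrary: c) auto

text \<open>Linear functions serve below both as Hamiltonians and as test functions.\<close>

lemma smooth_on_inner: "smooth_on UNIV (\<lambda>x. w \<bullet> x)"
proof -
  have "((\<lambda>x. w \<bullet> x) has_derivative (\<lambda>x. w \<bullet> x)) (at x)" for x
    by (auto intro!: derivative_eq_intros)
  then have D: "frechet_derivative (\<lambda>x. w \<bullet> x) (at x) = (\<lambda>x. w \<bullet> x)"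
    "(\<lambda>x. w \<bullet> x) differentiable (at x)" for x
    by (auto intro: frechet_derivative_at[symmetric] differentiableI)
  have "Ck_on k UNIV (\<lambda>x. w \<bullet> x)" for k
    by (cases k) (auto simp: D Ck_on_const intro!: continuous_intros)
  then show ?thesis
    unfolding smooth_on_def by (intro ballI exI[of _ UNIV] exI[of _ "\<lambda>x. w \<bullet> x"]) auto
qed

section \<open>Integral manifolds\<close>

text \<open>Restricting to a line reduces a derivative within \<open>U\<close> to an ordinary
  two-sided derivative in one variable, which is unique.\<close>

lemma has_vector_derivative_along_line:
  fixes f :: "'a::euclidean_space \<Rightarrow> 'b::real_normed_vector"
  assumes "openin (top_of_set V) U" "subspace V" "u \<in> U" "v \<in> V"
    and f: "(f has_derivative f') (at u within U)"
  shows "\<forall>\<^sub>F t in nhds (0::real). u + t *\<^sub>R v \<in> U"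
    and "((\<lambda>t. f (u + t *\<^sub>R v)) has_vector_derivative f' v) (at 0)"
proof -
  obtain W where W: "open W" "U = V \<inter> W"
    using assms(1) by (auto simp: openin_open)
  have "u + t *\<^sub>R v \<in> V" for t
    using assms(2-4) W by (auto intro: subspace_add subspace_scale)
  then have eq: "{t. u + t *\<^sub>R v \<in> U} = (\<lambda>t. u + t *\<^sub>R v) -` W"
    using W by auto
  \<comment> \<open>The line never leaves \<open>V\<close>, so only the open condition
    \<open>W\<close> remains. Openness later lets the derivative within this set be read as a
    derivative at 0.\<close>
  have op: "open {t. u + t *\<^sub>R v \<in> U}"
    unfolding eq by (intro open_vimage W continuous_intros)
  then show ev: "\<forall>\<^sub>F t in nhds (0::real). u + t *\<^sub>R v \<in> U"
    using assms(3) eventually_nhds_in_open[OF op, of 0] by simp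
  have "((\<lambda>t. f (u + t *\<^sub>R v)) has_derivative (\<lambda>d. f' (d *\<^sub>R v))) (at 0 within {t. u + t *\<^sub>R v \<in> U})"
  proof (rule has_derivative_in_compose[of "\<lambda>t. u + t *\<^sub>R v"])
    show "((\<lambda>t. u + t *\<^sub>R v) has_derivative (\<lambda>d. d *\<^sub>R v)) (at 0 within {t. u + t *\<^sub>R v \<in> U})"
      by (auto intro!: derivative_eq_intros)
    show "(f has_derivative f')
        (at (u + 0 *\<^sub>R v) within (\<lambda>t. u + t *\<^sub>R v) ` {t. u + t *\<^sub>R v \<in> U})"
      by (rule has_derivative_subset[of _ _ _ U]) (use f in auto)
  qed
  then show "((\<lambda>t. f (u + t *\<^sub>R v)) has_vector_derivative f' v) (at 0)"
    using at_within_open[OF _ op, of 0] assms(3)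
    by (simp add: has_vector_derivative_def linear_cmul[OF has_derivative_linear[OF f]])
qed

lemma has_vector_derivative_transform_nhds:
  assumes "(f has_vector_derivative d) (at x)" "\<forall>\<^sub>F t in nhds x. f t = g t"
  shows "(g has_vector_derivative d) (at x)"
proof -
  have "\<forall>\<^sub>F t in nhds x. t \<in> UNIV \<longrightarrow> f t = g t"
    using assms(2) by simp
  from has_vector_derivative_cong_ev[OF this eventually_nhds_x_imp_x[OF assms(2)]] assms(1)
  show ?thesis by simp
qed

text \<open>The difference quotients lie in \<open>V\<close>, which is closed.\<close>

lemma has_vector_derivative_in_subspace:
  fixes c :: "real \<Rightarrow> 'a::euclidean_space"
  assumes "(c has_vector_derivative d) (at 0)" "subspace V" "\<forall>\<^sub>F t in nhds 0. c t \<in> V"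
  shows "d \<in> V"
proof (rule Lim_in_closed_set[of V _ "at 0"])
  show "closed V" by (rule closed_subspace[OF assms(2)])
  have "c 0 \<in> V" using assms(3) by (rule eventually_nhds_x_imp_x)
  then show "\<forall>\<^sub>F t in at 0. (1 / t) *\<^sub>R (c t - c 0) \<in> V"
    using assms(2,3) unfolding eventually_at_filter
    by (auto elim!: eventually_mono intro: subspace_scale subspace_diff)
  show "((\<lambda>t. (1 / t) *\<^sub>R (c t - c 0)) \<longlongrightarrow> d) (at 0)"
    using assms(1) unfolding has_vector_derivative_def has_derivative_def
  proof (elim conjE)
    assume "((\<lambda>y. (c y - c (netlimit (at 0)) - (y - netlimit (at 0)) *\<^sub>R d) /\<^sub>R
      norm (y - netlimit (at 0))) \<longlongrightarrow> 0) (at 0)"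
    \<comment> \<open>The remainder is divided by the norm of \<open>y\<close>, the difference
      quotient by \<open>y\<close> itself; after taking norms the sign is irrelevant.\<close>
    then have "((\<lambda>y. norm ((c y - c 0 - y *\<^sub>R d) /\<^sub>R norm y)) \<longlongrightarrow> 0) (at 0)"
      by (intro tendsto_norm_zero) simp
    then have "((\<lambda>y. norm ((1 / y) *\<^sub>R (c y - c 0) - d)) \<longlongrightarrow> 0) (at 0)"
    proof (rule Lim_transform_eventually)
      show "\<forall>\<^sub>F y in at 0. norm ((c y - c 0 - y *\<^sub>R d) /\<^sub>R norm y) = norm ((1 / y) *\<^sub>R (c y - c 0) - d)"
        unfolding eventually_at_filter
      proof (intro always_eventually allI impI)
        fix y :: real assume "y \<noteq> 0"
        then have "(1 / y) *\<^sub>R (c y - c 0) - d = (1 / y) *\<^sub>R (c y - c 0 - y *\<^sub>R d)"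
          by (simp add: scaleR_right_diff_distrib)
        then show "norm ((c y - c 0 - y *\<^sub>R d) /\<^sub>R norm y) = norm ((1 / y) *\<^sub>R (c y - c 0) - d)"
          by (simp add: divide_inverse_commute)
      qed
    qed
    then show ?thesis
      using LIM_zero_cancel tendsto_norm_zero_iff by blast
  qed
qed simp

section \<open>Charts, transition maps and tangent spaces\<close>

lemma immersed_submanifold_chart:
  assumes "immersed_submanifold T V A" "(U, \<phi>) \<in> A"
  shows "openin (top_of_set V) U" "openin T (\<phi> ` U)" "smooth_on U \<phi>"
    "homeomorphic_map (top_of_set U) (subtopology T (\<phi> ` U)) \<phi>"
proof -
  have "openin (top_of_set V) U \<and> openin T (\<phi> ` U) \<and>
      homeomorphic_map (top_of_set U) (subtopology T (\<phi> ` U)) \<phi> \<and> smooth_on U \<phi>"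
    using assms unfolding immersed_submanifold_def
    by - (elim conjE, drule (1) bspec, simp)
  then show "openin (top_of_set V) U" "openin T (\<phi> ` U)" "smooth_on U \<phi>"
    "homeomorphic_map (top_of_set U) (subtopology T (\<phi> ` U)) \<phi>"
    by auto
qed

lemma immersed_submanifold_transition:
  assumes "immersed_submanifold T V A" "(U, \<phi>) \<in> A" "(W, \<psi>) \<in> A"
  shows "smooth_on (U \<inter> \<phi> -` (\<psi> ` W)) (inv_into W \<psi> \<circ> \<phi>)"
proof -
  have "\<forall>(U, \<phi>)\<in>A. \<forall>(W, \<psi>)\<in>A. smooth_on (U \<inter> \<phi> -` (\<psi> ` W)) (inv_into W \<psi> \<circ> \<phi>)"
    using assms(1) unfolding immersed_submanifold_def by (elim conjE) assumption
  from bspec[OF this assms(2)]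
  have "\<forall>(W, \<psi>)\<in>A. smooth_on (U \<inter> \<phi> -` (\<psi> ` W)) (inv_into W \<psi> \<circ> \<phi>)"
    by (simp only: prod.case)
  from bspec[OF this assms(3)] show ?thesis
    by (simp only: prod.case)
qed

lemma immersed_submanifold_topspace:
  assumes "immersed_submanifold T V A"
  shows "topspace T = (\<Union>(U, \<phi>)\<in>A. \<phi> ` U)"
  using assms unfolding immersed_submanifold_def by (elim conjE) simp

text \<open>
  The tangent space is a union over all charts through the point. Pulling a line in one chart back
  through the transition map shows that each single chart already yields all of it.
\<close>

lemma tangent_space_at_chart:
  fixes A :: "('a::euclidean_space set \<times> ('a \<Rightarrow> 'a)) set"
  assumes M: "immersed_submanifold T V A"
    and chart: "(U, \<phi>) \<in> A" "u \<in> U" "\<phi> u = p"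
    and g: "open N" "u \<in> N" "\<And>y. y \<in> U \<inter> N \<Longrightarrow> g y = \<phi> y" "(g has_derivative g') (at u)"
    and w: "w \<in> tangent_space_at V A p"
  shows "w \<in> g' ` V"
proof -
  obtain W \<psi> b \<psi>' v where W: "(W, \<psi>) \<in> A" "b \<in> W" "\<psi> b = p"
    "(\<psi> has_derivative \<psi>') (at b within W)" "v \<in> V" "w = \<psi>' v"
    using w unfolding tangent_space_at_def by blast
  have V: "subspace V" using M by (simp add: immersed_submanifold_def)
  note charts = immersed_submanifold_chart[OF M]
  \<comment> \<open>\<open>S\<close> is the part of the second chart domain that lands in the image
    of the first, and \<open>\<tau>\<close> is the transition map into \<open>U\<close>.\<close>
  define S where "S = W \<inter> \<psi> -` (\<phi> ` U)"
  define \<tau> where "\<tau> = inv_into U \<phi> \<circ> \<psi>"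
  have "smooth_on S \<tau>"
    unfolding S_def \<tau>_def by (rule immersed_submanifold_transition[OF M W(1) chart(1)])
  have inj: "inj_on \<phi> U"
    using homeomorphic_imp_injective_map[OF charts(4)[OF chart(1)]] by simp
  have bS: "b \<in> S" using W(2,3) chart(2,3) by (auto simp: S_def intro: image_eqI[of _ _ u])
  have S: "openin (top_of_set V) S"
  proof -
    have "continuous_map (top_of_set W) T \<psi>"
      using homeomorphic_imp_continuous_map[OF charts(4)[OF W(1)]]
      by (simp add: continuous_map_in_subtopology)
    from openin_continuous_map_preimage[OF this charts(2)[OF chart(1)]]
    have "openin (top_of_set W) {y \<in> topspace (top_of_set W). \<psi> y \<in> \<phi> ` U}" .
    also have "{y \<in> topspace (top_of_set W). \<psi> y \<in> \<phi> ` U} = S"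
      by (auto simp: S_def)
    finally have "openin (top_of_set W) S" .
    with charts(1)[OF W(1)] show ?thesis
      by (rule openin_trans[rotated])
  qed
  obtain \<tau>' where \<tau>': "(\<tau> has_derivative \<tau>') (at b within S)"
    using smooth_on_has_derivative_extension[OF \<open>smooth_on S \<tau>\<close> bS] bS by blast
  define c where "c = (\<lambda>t. \<tau> (b + t *\<^sub>R v))"
  have ev: "\<forall>\<^sub>F t in nhds (0::real). b + t *\<^sub>R v \<in> S"
    and c: "(c has_vector_derivative \<tau>' v) (at 0)"
    unfolding c_def
    using has_vector_derivative_along_line[OF S V bS \<open>v \<in> V\<close> \<tau>'] by auto
  have \<tau>S: "\<tau> y \<in> U" "\<phi> (\<tau> y) = \<psi> y" if "y \<in> S" for y
    using that by (auto simp: S_def \<tau>_def inv_into_into f_inv_into_f)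
  have "\<psi> b = \<phi> u" using W(3) chart(3) by simp
  then have c0: "c 0 = u"
    using inv_into_f_f[OF inj chart(2)] by (simp add: c_def \<tau>_def)
  have UV: "U \<subseteq> V" using charts(1)[OF chart(1)] by (simp add: openin_imp_subset)
  \<comment> \<open>The derivative \<open>\<tau>'\<close> is a map of the whole ambient space; it
    sends \<open>v\<close> into \<open>V\<close> because the curve \<open>c\<close> runs in
    \<open>U\<close> near 0.\<close>
  have \<tau>V: "\<tau>' v \<in> V"
  proof (rule has_vector_derivative_in_subspace[OF c V])
    show "\<forall>\<^sub>F t in nhds 0. c t \<in> V"
      using ev by eventually_elim (use \<tau>S UV in \<open>auto simp: c_def\<close>)
  qed
  \<comment> \<open>Using \<open>g\<close> in place of \<open>\<phi>\<close> gives a derivative in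
    the full ambient space, so the chain rule applies even though \<open>c\<close> may leave
    \<open>U\<close> away from 0.\<close>
  have "(g has_derivative g') (at (c 0) within range c)"
    using g(4) c0 by (simp add: has_derivative_at_withinI)
  from vector_derivative_diff_chain_within[OF c this]
  have gc: "((\<lambda>t. g (c t)) has_vector_derivative g' (\<tau>' v)) (at 0)"
    by (simp add: o_def)
  have \<psi>: "((\<lambda>t. \<psi> (b + t *\<^sub>R v)) has_vector_derivative w) (at 0)"
    using has_vector_derivative_along_line(2)[OF charts(1)[OF W(1)] V W(2,5,4)] W(6) by simp
  have "\<forall>\<^sub>F t in nhds 0. c t \<in> N"
  proof -
    have "isCont c 0" using c by (rule has_vector_derivative_continuous)
    then have "(c \<longlongrightarrow> u) (at 0)"
      using c0 by (simp add: isCont_def)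
    then have "\<forall>\<^sub>F t in at 0. c t \<in> N"
      using g(1,2) by (rule topological_tendstoD)
    then show ?thesis
      using c0 g(2) by (simp add: eventually_nhds_conv_at)
  qed
  then have eq: "\<forall>\<^sub>F t in nhds 0. g (c t) = \<psi> (b + t *\<^sub>R v)"
    using ev by eventually_elim (use \<tau>S g(3) in \<open>auto simp: c_def\<close>)
  \<comment> \<open>The same curve now has two computed velocities, \<open>w\<close> and
    \<open>g' (\<tau>' v)\<close>.\<close>
  have "((\<lambda>t. \<psi> (b + t *\<^sub>R v)) has_vector_derivative g' (\<tau>' v)) (at 0)"
    using gc eq by (rule has_vector_derivative_transform_nhds)
  with \<psi> have "w = g' (\<tau>' v)" by (rule vector_derivative_unique_at)
  then show ?thesis using \<tau>V by blast
qed

text \<open>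
  A one-form with coefficients linear in the base point has exterior derivative
  \<open>B v w - B w v\<close>; this is the necessity half of Frobenius' criterion for it.
\<close>

lemma integral_manifold_symmetric:
  fixes B :: "'a::euclidean_space \<Rightarrow> 'a \<Rightarrow> real"
  assumes M: "immersed_submanifold T V A" and p: "p \<in> topspace T"
    and B: "bounded_bilinear B"
    and kernel: "\<And>q X. q \<in> topspace T \<Longrightarrow> X \<in> tangent_space_at V A q \<Longrightarrow> B q X = 0"
    and w: "w\<^sub>1 \<in> tangent_space_at V A p" "w\<^sub>2 \<in> tangent_space_at V A p"
  shows "B w\<^sub>1 w\<^sub>2 = B w\<^sub>2 w\<^sub>1"
proof -
  interpret bounded_bilinear B by fact
  have V: "subspace V" using M by (simp add: immersed_submanifold_def)
  obtain U \<phi> u where chart: "(U, \<phi>) \<in> A" "u \<in> U" "\<phi> u = p"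
    using p unfolding immersed_submanifold_topspace[OF M] by blast
  have U: "openin (top_of_set V) U" "smooth_on U \<phi>"
    using immersed_submanifold_chart[OF M chart(1)] by auto
  have top: "\<phi> y \<in> topspace T" if "y \<in> U" for y
    using chart(1) that unfolding immersed_submanifold_topspace[OF M] by blast
  obtain N g where "open N \<and> u \<in> N \<and> Ck_on 2 N g \<and> (\<forall>y\<in>U \<inter> N. g y = \<phi> y) \<and>
      (\<forall>y\<in>N. (g has_derivative frechet_derivative g (at y)) (at y)) \<and>
      (\<forall>y\<in>U \<inter> N. (\<phi> has_derivative frechet_derivative g (at y)) (at y within U))"
    using smooth_on_has_derivative_extension[OF U(2) chart(2)] by (elim exE)
  then have N: "open N" "u \<in> N" "Ck_on 2 N g" "\<And>y. y \<in> U \<inter> N \<Longrightarrow> g y = \<phi> y"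
    "\<And>y. y \<in> N \<Longrightarrow> (g has_derivative frechet_derivative g (at y)) (at y)"
    "\<And>y. y \<in> U \<inter> N \<Longrightarrow> (\<phi> has_derivative frechet_derivative g (at y)) (at y within U)"
    by simp_all
  let ?F = "\<lambda>y v. frechet_derivative g (at y) v"
  let ?G = "\<lambda>v y. frechet_derivative (\<lambda>z. ?F z v) (at y)"
  obtain v\<^sub>1 v\<^sub>2 where v: "v\<^sub>1 \<in> V" "w\<^sub>1 = ?F u v\<^sub>1" "v\<^sub>2 \<in> V" "w\<^sub>2 = ?F u v\<^sub>2"
    using tangent_space_at_chart[OF M chart N(1,2,4) N(5)[OF N(2)]] w by blast
  \<comment> \<open>The pullback of the one-form to the chart vanishes.\<close>
  have zero: "B (g y) (?F y v) = 0" if "y \<in> U \<inter> N" "v \<in> V" for y v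
  proof -
    have "?F y v \<in> tangent_space_at V A (\<phi> y)"
      unfolding tangent_space_at_def using chart(1) that N(6) by blast
    then show ?thesis using kernel[OF top] that N(4) by simp
  qed
  have F: "((\<lambda>z. ?F z v) has_derivative ?G v u) (at u)" for v
    using N(2,3) by (auto simp: numeral_2_eq_2 frechet_derivative_works[symmetric])
  \<comment> \<open>Differentiate \<open>zero\<close>, taken for the constant direction
    \<open>a\<close>, along \<open>b\<close>; the product rule yields these two terms.\<close>
  have "B (?F u b) (?F u a) = - B (g u) (?G a u b)" if "a \<in> V" "b \<in> V" for a b
  proof -
    have h: "((\<lambda>y. B (g y) (?F y a)) has_derivative
        (\<lambda>d. B (g u) (?G a u d) + B (?F u d) (?F u a))) (at u within U)"
      by (rule has_derivative_at_withinI[OF FDERIV[OF N(5)[OF N(2)] F]])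
    have hb: "((\<lambda>t. B (g (u + t *\<^sub>R b)) (?F (u + t *\<^sub>R b) a)) has_vector_derivative
        B (g u) (?G a u b) + B (?F u b) (?F u a)) (at 0)"
      and evU: "\<forall>\<^sub>F t in nhds (0::real). u + t *\<^sub>R b \<in> U"
      using has_vector_derivative_along_line[OF U(1) V chart(2) that(2) h] by auto
    have "\<forall>\<^sub>F t in nhds (0::real). B (g (u + t *\<^sub>R b)) (?F (u + t *\<^sub>R b) a) = 0"
    proof -
      have "((\<lambda>t::real. u + t *\<^sub>R b) \<longlongrightarrow> u + 0 *\<^sub>R b) (nhds 0)"
        by (intro tendsto_intros filterlim_ident)
      from topological_tendstoD[OF this N(1)] have "\<forall>\<^sub>F t in nhds (0::real). u + t *\<^sub>R b \<in> N"
        using N(2) by simp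
      with evU show ?thesis
        by eventually_elim (use zero that in auto)
    qed
    with hb have "((\<lambda>t. 0) has_vector_derivative
        B (g u) (?G a u b) + B (?F u b) (?F u a)) (at (0::real))"
      by (rule has_vector_derivative_transform_nhds)
    then have "B (g u) (?G a u b) + B (?F u b) (?F u a) = 0"
      by (rule vector_derivative_unique_at) (rule has_vector_derivative_const)
    then show ?thesis by simp
  qed
  \<comment> \<open>The second derivative of \<open>g\<close> is symmetric, so the right side is
    unchanged when \<open>a\<close> and \<open>b\<close> are swapped, and hence so is the
    left.\<close>
  then show ?thesis
    using v Ck_on_2_symmetric[OF N(3,1,2), of v\<^sub>1 v\<^sub>2] by simp
qed

section \<open>The rank zero bracket\<close>

lemma gradient_eq: "GDERIV f x :> D \<Longrightarrow> gradient f x = D"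
  unfolding gradient_def
proof (rule the_equality)
  fix D' assume "GDERIV f x :> D" "GDERIV f x :> D'"
  then have "(\<lambda>h. h \<bullet> D) = (\<lambda>h. h \<bullet> D')"
    unfolding gderiv_def by (rule has_derivative_unique)
  then show "D' = D"
    by (metis vector_eq_ldot)
qed

text \<open>Riesz representation: the representing vector is the adjoint of \<open>f'\<close>
  applied to 1.\<close>

lemma has_derivative_eq_inner_gradient:
  fixes f :: "'a::euclidean_space \<Rightarrow> real"
  assumes "(f has_derivative f') (at x)"
  shows "f' v = v \<bullet> gradient f x"
proof -
  have "f' h = h \<bullet> adjoint f' 1" for h
    using adjoint_works[OF has_derivative_linear[OF assms], of h 1] by simp
  then have "f' = (\<lambda>h. h \<bullet> adjoint f' 1)" by blast
  with assms have "GDERIV f x :> adjoint f' 1"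
    by (simp add: gderiv_def)
  with \<open>f' v = v \<bullet> adjoint f' 1\<close> show ?thesis
    by (simp add: gradient_eq)
qed

lemma frechet_derivative_partial_gradients:
  fixes g :: "'a::euclidean_space \<times> 'b::euclidean_space \<Rightarrow> real"
  assumes "g differentiable (at (\<gamma>, K))"
  shows "frechet_derivative g (at (\<gamma>, K)) (u, v) =
    u \<bullet> gradient (\<lambda>\<gamma>'. g (\<gamma>', K)) \<gamma> + v \<bullet> gradient (\<lambda>K'. g (\<gamma>, K')) K"
proof -
  let ?L = "frechet_derivative g (at (\<gamma>, K))"
  have L: "(g has_derivative ?L) (at (\<gamma>, K))"
    using assms by (simp add: frechet_derivative_works[symmetric])
  have "((\<lambda>\<gamma>'. g (\<gamma>', K)) has_derivative (\<lambda>h. ?L (h, 0))) (at \<gamma>)"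
    by (rule has_derivative_compose[where f = "\<lambda>\<gamma>'. (\<gamma>', K)", OF _ L])
      (auto intro!: derivative_eq_intros)
  moreover have "((\<lambda>K'. g (\<gamma>, K')) has_derivative (\<lambda>h. ?L (0, h))) (at K)"
    by (rule has_derivative_compose[where f = "Pair \<gamma>", OF _ L])
      (auto intro!: derivative_eq_intros)
  moreover have "?L (u, v) = ?L (u, 0) + ?L (0, v)"
    using linear_add[OF has_derivative_linear[OF L], of "(u, 0)" "(0, v)"] by simp
  ultimately show ?thesis
    using has_derivative_eq_inner_gradient by metis
qed

lemma gradient_inner: "gradient (\<lambda>x. w \<bullet> x + c) x = w"
  by (rule gradient_eq) (auto simp: gderiv_def inner_commute intro!: derivative_eq_intros)

lemma frechet_derivative_inner: "frechet_derivative (\<lambda>x. w \<bullet> x) (at x) v = w \<bullet> v"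
  by (subst frechet_derivative_at[of _ "\<lambda>v. w \<bullet> v", symmetric]) (auto intro!: derivative_eq_intros)

section \<open>Annihilator and Hamiltonian vector fields of the bracket\<close>

definition rank0_momentum :: "real \<Rightarrow> real \<Rightarrow> real^3^3 \<Rightarrow> real^3 \<Rightarrow> real^3" where
  "rank0_momentum m r \<I> K = K - (m * r\<^sup>2) *\<^sub>R (matrix_inv \<I> *v K)"

text \<open>Take as test function the linear one whose coefficients are those of \<alpha> frozen at
  the given point. Its bracket with any \<open>f\<close> vanishes there: one triple product repeats
  \<gamma>, and the other two cancel.\<close>

lemma rank0_characteristic_annihilator:
  assumes "X \<in> characteristic_distribution (rank0_bracket m r \<I>) (\<gamma>, K)"
  shows "\<gamma> \<bullet> snd X + rank0_momentum m r \<I> K \<bullet> fst X = 0"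
proof -
  let ?M = "rank0_momentum m r \<I> K"
  let ?g = "\<lambda>y. (?M, \<gamma>) \<bullet> y"
  have "(?M, \<gamma>) \<bullet> Y (\<gamma>, K) = 0" if "is_hamiltonian_vf (rank0_bracket m r \<I>) f Y" for f Y
  proof -
    have "(?M, \<gamma>) \<bullet> Y (\<gamma>, K) = rank0_bracket m r \<I> ?g f (\<gamma>, K)"
      using that smooth_on_inner[of "(?M, \<gamma>)"] frechet_derivative_inner
      unfolding is_hamiltonian_vf_def by metis
    also have "\<dots> = 0"
      using gradient_inner[of ?M "\<gamma> \<bullet> K" \<gamma>] gradient_inner[of \<gamma> "?M \<bullet> \<gamma>" K]
      by (simp add: rank0_bracket_def Let_def rank0_momentum_def[symmetric] add.commute)
         (simp add: cross3_simps)
    finally show ?thesis .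
  qed
  then have "characteristic_distribution (rank0_bracket m r \<I>) (\<gamma>, K) \<subseteq> {X. (?M, \<gamma>) \<bullet> X = 0}"
    unfolding characteristic_distribution_def
    by (intro span_minimal subspace_hyperplane) auto
  with assms show ?thesis
    by (cases X) (auto simp: add.commute)
qed

text \<open>The Hamiltonian is linear with constant gradients \<open>b\<close> in \<gamma> and
  \<open>a\<close> in \<open>K\<close>; cyclic symmetry of the triple product isolates the gradients
  of the test function.\<close>

lemma rank0_linear_hamiltonian_vf:
  "(cross3 \<gamma> a, cross3 (rank0_momentum m r \<I> K) a + cross3 \<gamma> b)
     \<in> characteristic_distribution (rank0_bracket m r \<I>) (\<gamma>, K)"
proof -
  let ?M = "rank0_momentum m r \<I>"
  let ?f = "\<lambda>y. (b, a) \<bullet> y"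
  let ?X = "\<lambda>(\<gamma>, K). (cross3 \<gamma> a, cross3 (?M K) a + cross3 \<gamma> b)"
  have "is_hamiltonian_vf (rank0_bracket m r \<I>) ?f ?X"
    unfolding is_hamiltonian_vf_def
  proof (intro allI impI)
    fix g :: "(real^3) \<times> (real^3) \<Rightarrow> real" and x :: "(real^3) \<times> (real^3)"
    assume g: "smooth_on UNIV g"
    obtain \<gamma> K where x: "x = (\<gamma>, K)" by fastforce
    have a: "gradient (\<lambda>K'. ?f (\<gamma>, K')) K = a" and b: "gradient (\<lambda>\<gamma>'. ?f (\<gamma>', K)) \<gamma> = b"
      for \<gamma> K :: "real^3"
      using gradient_inner[of b "a \<bullet> K" \<gamma>] gradient_inner[of a "b \<bullet> \<gamma>" K]
      by (simp_all add: add.commute)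
    show "frechet_derivative g (at x) (?X x) = rank0_bracket m r \<I> g ?f x"
      unfolding x rank0_bracket_def Let_def prod.case a b rank0_momentum_def[symmetric]
        frechet_derivative_partial_gradients[OF smooth_on_UNIV_differentiable[OF g]]
      by (simp add: cross3_simps)
  qed
  then have "?X (\<gamma>, K) \<in> characteristic_distribution (rank0_bracket m r \<I>) (\<gamma>, K)"
    unfolding characteristic_distribution_def using smooth_on_inner by (blast intro: span_base)
  then show ?thesis by simp
qed

text \<open>\<open>matrix_inv\<close> is defined by choice, so the reciprocal diagonal matrix first
  witnesses invertibility, and then the left inverse property is applied to a preimage of the axis
  vector.\<close>

lemma matrix_inv_diag3_axis:
  assumes "a \<noteq> 0" "b \<noteq> 0" "c \<noteq> 0"
  shows "matrix_inv (diag3 a b c) *v axis 1 1 = (1 / a) *\<^sub>R axis 1 1"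
proof -
  have "diag3 a b c ** diag3 (1 / a) (1 / b) (1 / c) = mat 1"
    using assms
    by (simp add: diag3_def matrix_matrix_mult_def mat_def vec_eq_iff forall_3 sum_3 vector_3)
  then have "invertible (diag3 a b c)"
    by (metis invertible_right_inverse)
  then have "matrix_inv (diag3 a b c) ** diag3 a b c = mat 1"
    unfolding invertible_def matrix_inv_def by (rule someI2_ex) simp
  moreover have "axis 1 1 = diag3 a b c *v ((1 / a) *\<^sub>R axis 1 1)"
    using assms
    by (simp add: diag3_def matrix_vector_mult_def axis_def vec_eq_iff forall_3 sum_3 vector_3)
  ultimately show ?thesis
    by (metis matrix_vector_mul_assoc matrix_vector_mul_lid)
qed

theorem proposition2p6:
  fixes m r I\<^sub>1 I\<^sub>2 I\<^sub>3 :: real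
  assumes "m > 0" and "r > 0" and "I\<^sub>1 > 0" and "I\<^sub>2 > 0" and "I\<^sub>3 > 0"
  shows "\<not> integrable_distribution
           (characteristic_distribution (rank0_bracket m r (diag3 I\<^sub>1 I\<^sub>2 I\<^sub>3)))"
proof
  let ?\<I> = "diag3 I\<^sub>1 I\<^sub>2 I\<^sub>3"
  let ?D = "characteristic_distribution (rank0_bracket m r ?\<I>)"
  let ?M = "rank0_momentum m r ?\<I>"
  let ?p = "(axis 3 1, 0) :: (real^3) \<times> (real^3)"
  let ?e = "axis 1 1 :: real^3"
  assume "integrable_distribution ?D"
  then obtain T V A where M: "immersed_submanifold T V A" "?p \<in> topspace T"
    and D: "\<And>q. q \<in> topspace T \<Longrightarrow> tangent_space_at V A q = ?D q"
    unfolding integrable_distribution_def by metis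
  \<comment> \<open>The one-form \<alpha> at base point \<open>q\<close>; linearity of
    \<open>?M\<close> makes it bilinear.\<close>
  define B where "B = (\<lambda>(q :: (real^3) \<times> (real^3)) (X :: (real^3) \<times> (real^3)). fst q \<bullet> snd X + ?M (snd q) \<bullet> fst X)"
  have linM: "linear ?M"
    unfolding rank0_momentum_def
    by (intro linear_compose_sub linear_id[unfolded id_def] linear_compose_scale_right
        matrix_vector_mul_linear)
  have "bilinear B"
    unfolding bilinear_def B_def
    by (intro allI conjI linearI)
      (auto simp: linear_add[OF linM] linear_cmul[OF linM] inner_simps algebra_simps)
  then have B: "bounded_bilinear B" by (simp only: bilinear_conv_bounded_bilinear)
  have kernel: "B q X = 0" if "q \<in> topspace T" "X \<in> tangent_space_at V A q" for q X
    using rank0_characteristic_annihilator[of X m r ?\<I> "fst q" "snd q"] that D by (simp add: B_def)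
  have cross: "cross3 (axis 3 1) (axis 2 1) = - ?e"
    by (simp add: cross_basis)
  have M0: "?M 0 = 0" using linM by (rule linear_0)
  \<comment> \<open>The choice of \<open>- axis 2 1\<close> comes from \<open>cross\<close>; placed
    in \<open>a\<close> it gives the first vector, since \<open>?M 0 = 0\<close>, and placed in
    \<open>b\<close> the second.\<close>
  have "(?e, 0) \<in> ?D ?p" "(0, ?e) \<in> ?D ?p"
    using rank0_linear_hamiltonian_vf[of "axis 3 1" "- axis 2 1" m r ?\<I> 0 0]
      rank0_linear_hamiltonian_vf[of "axis 3 1" 0 m r ?\<I> 0 "- axis 2 1"]
    by (simp_all add: cross M0)
  with D[OF M(2)] have "B (?e, 0) (0, ?e) = B (0, ?e) (?e, 0)"
    using integral_manifold_symmetric[OF M B kernel] by simp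
  moreover have "?M ?e = (1 - m * r\<^sup>2 / I\<^sub>1) *\<^sub>R ?e"
    using assms by (simp add: rank0_momentum_def matrix_inv_diag3_axis scaleR_left_diff_distrib)
  \<comment> \<open>The two sides of the symmetry evaluate to 1 and
    \<open>1 - m * r\<^sup>2 / I\<^sub>1\<close>.\<close>
  ultimately have "m * r\<^sup>2 / I\<^sub>1 = 0"
    by (simp add: B_def M0 inner_axis_axis)
  then show False using assms by simp
qed

end
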